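(* There exist P-rankable sets $A, B\subseteq\Sigma^*$ such that $A\cap B$ is infinite but not $\mathrm{F}_{\mathrm{PR}}$-compressible.
   Context: $\Sigma=\{0,1\}$; strings are ordered in length-lexicographic order, and natural numbers are identified with strings in the standard way. For $A\subseteq\Sigma^*$, $\mathrm{rank}_A(y)=\|\{z\mid z\le y \wedge z\in A\}\|$. A (possibly partial) function $f$ is a ranking function for $A$ if $\mathrm{domain}(f)\supseteq A$ and $f(x)=\mathrm{rank}_A(x)$ for all $x\in A$ (no requirement for $x\notin A$). $A$ is P-rankable if it has a ranking function that is a total polynomial-time computable function. A (possibly partial) function $f$ is a compression function for $A$ if $\mathrm{domain}(f)\supseteq A$, $f(A)=\Sigma^*$, and $f$ is injective on $A$. $\mathrm{F}_{\mathrm{PR}}$ is the class of partial recursive functions from $\Sigma^*$ to $\Sigma^*$, and $A$ is $\mathrm{F}_{\mathrm{PR}}$-compressible if some $f\in\mathrm{F}_{\mathrm{PR}}$ is a compression function for $A$. *)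

theory Defs
  imports "HOL-Library.List_Lenlexorder" "HOL-Computational_Algebra.Polynomial"
begin

text \<open>
  Strings over the alphabet \<open>{0,1}\<close> are lists of Booleans (\<open>0\<close> is \<open>False\<close>, \<open>1\<close> is \<open>True\<close>, leftmost
  letter first). The orders \<open>\<le>\<close> and \<open><\<close> on them are the length-lexicographic ones of
  \<^theory>\<open>HOL-Library.List_Lenlexorder\<close>.
\<close>

type_synonym str = "bool list"

lemma finite_atMost_str: "finite {z :: str. z \<le> y}"
proof (rule finite_subset)
  show "{z. z \<le> y} \<subseteq> {z :: str. set z \<subseteq> UNIV \<and> length z \<le> length y}"
    by (auto simp: list_le_def list_less_def lenlex_conv)
  show "finite {z :: str. set z \<subseteq> UNIV \<and> length z \<le> length y}"
    by (rule finite_lists_length_le) simp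
qed

lemma finite_lessThan_str: "finite {z :: str. z < y}"
  by (rule finite_subset[OF _ finite_atMost_str[of y]]) auto

text \<open>The standard identification of strings with natural numbers: the empty string is 0,
  and then \<open>0, 1, 00, 01, \<dots>\<close> are \<open>1, 2, 3, 4, \<dots>\<close>\<close>

definition nat_of_str :: "str \<Rightarrow> nat" where
  "nat_of_str w = card {z. z < w}"

lemma bij_nat_of_str: "bij nat_of_str"
proof -
  have mono: "nat_of_str v < nat_of_str w" if "v < w" for v w
    unfolding nat_of_str_def
    by (rule psubset_card_mono[OF finite_lessThan_str]) (use that in auto)
  have "inj nat_of_str"
    by (rule injI) (metis mono less_irrefl linorder_less_linear)
  moreover have "\<exists>w. nat_of_str w = n" for n
  proof (induction n)
    case 0
    have "{z :: str. z < []} = {}"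
      by (auto simp: list_less_def)
    then have "nat_of_str [] = 0"
      by (simp add: nat_of_str_def)
    then show ?case ..
  next
    case (Suc n)
    then obtain w where w: "nat_of_str w = n" ..
    define S where "S = {z. w < z \<and> z \<le> w @ [True]}"
    have fin: "finite S"
      unfolding S_def by (rule finite_subset[OF _ finite_atMost_str[of "w @ [True]"]]) auto
    have mem: "w @ [True] \<in> S"
      by (simp add: S_def list_less_def lenlex_conv)
    define v where "v = Min S"
    have v: "v \<in> S"
      unfolding v_def using fin mem by (intro Min_in) auto
    have "z \<le> w" if "z < v" for z
    proof (rule ccontr)
      assume "\<not> z \<le> w"
      with that v have "z \<in> S"
        by (auto simp: S_def)
      then have "v \<le> z"
        unfolding v_def using fin by simp
      with that show False
        by simp
    qed
    then have "{z. z < v} = insert w {z. z < w}"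
      using v by (force simp: S_def)
    then have "nat_of_str v = Suc n"
      using w finite_lessThan_str[of w] by (simp add: nat_of_str_def)
    then show ?case ..
  qed
  then have "surj nat_of_str"
    by (metis surjI)
  ultimately show ?thesis
    by (rule bijI)
qed

text \<open>
  Deterministic single-tape Turing machines with a two-way infinite tape. A machine is its finite
  transition table, read as the partial function \<^const>\<open>map_of\<close> (so that the first matching entry
  counts): a state and a scanned symbol determine the new state, the symbol written, and the move.
  The start state is 0, and a machine halts when no entry applies. As a table is finite, only
  finitely many states and tape symbols matter to it.
\<close>

datatype symbol = Blank | Bit bool | Mark nat

datatype move = Left | Stay | Right

type_synonym tm = "((nat \<times> symbol) \<times> (nat \<times> symbol \<times> move)) list"

record config =
  state :: nat
  head :: int
  tape :: "int \<Rightarrow> symbol"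

fun offset :: "move \<Rightarrow> int" where
  "offset Left = - 1"
| "offset Stay = 0"
| "offset Right = 1"

definition transition :: "tm \<Rightarrow> config \<Rightarrow> (nat \<times> symbol \<times> move) option" where
  "transition M c = map_of M (state c, tape c (head c))"

definition halted :: "tm \<Rightarrow> config \<Rightarrow> bool" where
  "halted M c \<longleftrightarrow> transition M c = None"

definition step :: "tm \<Rightarrow> config \<Rightarrow> config" where
  "step M c = (case transition M c of
     None \<Rightarrow> c
   | Some (q, s, m) \<Rightarrow>
       \<lparr>state = q, head = head c + offset m, tape = (tape c)(head c := s)\<rparr>)"

definition initial :: "str \<Rightarrow> config" where
  "initial x = \<lparr>state = 0, head = 0,
     tape = (\<lambda>i. if 0 \<le> i \<and> i < int (length x) then Bit (x ! nat i) else Blank)\<rparr>"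

text \<open>The output is the maximal block of bits that starts at the head position and extends to
  the right.\<close>

definition has_output :: "config \<Rightarrow> str \<Rightarrow> bool" where
  "has_output c w \<longleftrightarrow>
     (\<forall>i < length w. tape c (head c + int i) = Bit (w ! i)) \<and>
     tape c (head c + int (length w)) \<notin> range Bit"

lemma has_output_unique:
  assumes "has_output c v" "has_output c w"
  shows "v = w"
proof -
  have "length v = length w"
    using assms by (metis has_output_def nat_neq_iff rangeI)
  then show ?thesis
    using assms by (intro nth_equalityI) (auto simp: has_output_def)
qed

text \<open>\<open>step\<close> leaves halted configurations unchanged, so this says that \<open>M\<close> halts on input \<open>x\<close>
  after at most \<open>t\<close> steps, with output \<open>w\<close>.\<close>

definition computes_within :: "tm \<Rightarrow> str \<Rightarrow> nat \<Rightarrow> str \<Rightarrow> bool" where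
  "computes_within M x t w \<longleftrightarrow>
     (let c = (step M ^^ t) (initial x) in halted M c \<and> has_output c w)"

definition partial_recursive :: "(str \<rightharpoonup> str) \<Rightarrow> bool" where
  "partial_recursive f \<longleftrightarrow>
     (\<exists>M. \<forall>x w. f x = Some w \<longleftrightarrow> (\<exists>t. computes_within M x t w))"

definition polytime :: "(str \<Rightarrow> str) \<Rightarrow> bool" where
  "polytime f \<longleftrightarrow>
     (\<exists>M (p :: nat poly). \<forall>x. computes_within M x (poly p (length x)) (f x))"

definition rank :: "str set \<Rightarrow> str \<Rightarrow> nat" where
  "rank A y = card {z. z \<le> y \<and> z \<in> A}"

definition ranking_function :: "(str \<rightharpoonup> str) \<Rightarrow> str set \<Rightarrow> bool" where
  "ranking_function f A \<longleftrightarrow>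
     A \<subseteq> dom f \<and> (\<forall>x\<in>A. nat_of_str (the (f x)) = rank A x)"

definition P_rankable :: "str set \<Rightarrow> bool" where
  "P_rankable A \<longleftrightarrow> (\<exists>f. polytime f \<and> ranking_function (\<lambda>x. Some (f x)) A)"

definition compression_function :: "(str \<rightharpoonup> str) \<Rightarrow> str set \<Rightarrow> bool" where
  "compression_function f A \<longleftrightarrow>
     A \<subseteq> dom f \<and> (\<lambda>x. the (f x)) ` A = UNIV \<and> inj_on (\<lambda>x. the (f x)) A"

definition F_PR_compressible :: "str set \<Rightarrow> bool" where
  "F_PR_compressible A \<longleftrightarrow> (\<exists>f. partial_recursive f \<and> compression_function f A)"

end

theory Submission
  imports Defs "HOL-Analysis.Continuum_Not_Denumerable"
begin

text \<open>
  Let \<open>A\<close> contain exactly one of \<open>w0\<close> and \<open>w1\<close> for every nonempty \<open>w\<close>, and nothing else. Then the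
  rank of the member extending \<open>w\<close> is the number of \<open>w\<close>, so deleting the last letter ranks \<open>A\<close>,
  whatever the choices were. Two such sets can meet in \<open>{w0 | w \<in> C}\<close> for an arbitrary set \<open>C\<close> of
  nonempty strings. A function that compresses a set compresses no proper subset of it, so in an
  uncountable chain of sets, such as the one formed by the cuts in the rationals, some member is not
  compressed by any of the countably many Turing machines.
\<close>

section \<open>Deleting the last letter in linear time\<close>

definition butlast_tm :: tm where
  "butlast_tm =
    [((0, Bit False), (0, Bit False, Right)),
     ((0, Bit True), (0, Bit True, Right)),
     ((0, Blank), (1, Blank, Left)),
     ((1, Bit False), (2, Blank, Left)),
     ((1, Bit True), (2, Blank, Left)),
     ((2, Bit False), (2, Bit False, Left)),
     ((2, Bit True), (2, Bit True, Left)),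
     ((2, Blank), (3, Blank, Right))]"

definition str_tape :: "str \<Rightarrow> int \<Rightarrow> symbol" where
  "str_tape x = (\<lambda>i. if 0 \<le> i \<and> i < int (length x) then Bit (x ! nat i) else Blank)"

lemma initial_eq: "initial x = \<lparr>state = 0, head = 0, tape = str_tape x\<rparr>"
  by (simp add: initial_def str_tape_def)

lemma step_butlast_tm_right:
  assumes "t i = Bit b"
  shows "step butlast_tm \<lparr>state = 0, head = i, tape = t\<rparr> = \<lparr>state = 0, head = i + 1, tape = t\<rparr>"
  using assms by (cases b) (auto simp: step_def transition_def butlast_tm_def)

lemma step_butlast_tm_erase:
  assumes "t i = Bit b"
  shows "step butlast_tm \<lparr>state = 1, head = i, tape = t\<rparr> =
    \<lparr>state = 2, head = i - 1, tape = t(i := Blank)\<rparr>"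
  using assms by (cases b) (auto simp: step_def transition_def butlast_tm_def)

lemma step_butlast_tm_left:
  assumes "t i = Bit b"
  shows "step butlast_tm \<lparr>state = 2, head = i, tape = t\<rparr> = \<lparr>state = 2, head = i - 1, tape = t\<rparr>"
  using assms by (cases b) (auto simp: step_def transition_def butlast_tm_def)

lemma step_butlast_tm_Blank:
  assumes "t i = Blank"
  shows "step butlast_tm \<lparr>state = 0, head = i, tape = t\<rparr> = \<lparr>state = 1, head = i - 1, tape = t\<rparr>"
    and "step butlast_tm \<lparr>state = 1, head = i, tape = t\<rparr> = \<lparr>state = 1, head = i, tape = t\<rparr>"
    and "step butlast_tm \<lparr>state = 2, head = i, tape = t\<rparr> = \<lparr>state = 3, head = i + 1, tape = t\<rparr>"
  using assms by (auto simp: step_def transition_def butlast_tm_def)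

lemma steps_butlast_tm_right:
  assumes "n \<le> length x"
  shows "(step butlast_tm ^^ n) \<lparr>state = 0, head = 0, tape = str_tape x\<rparr> =
    \<lparr>state = 0, head = int n, tape = str_tape x\<rparr>"
  using assms
proof (induction n)
  case (Suc n)
  have "str_tape x (int n) = Bit (x ! n)"
    using Suc.prems by (simp add: str_tape_def)
  from step_butlast_tm_right[of "str_tape x", OF this] Suc show ?case
    by simp
qed simp

lemma steps_butlast_tm_left:
  assumes "n \<le> length x"
  shows "(step butlast_tm ^^ n) \<lparr>state = 2, head = int n - 1, tape = str_tape x\<rparr> =
    \<lparr>state = 2, head = - 1, tape = str_tape x\<rparr>"
  using assms
proof (induction n)
  case (Suc n)
  have "str_tape x (int n) = Bit (x ! n)"
    using Suc.prems by (simp add: str_tape_def)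
  \<comment> \<open>The first step is split off, not the last: it leaves the head where the
    induction hypothesis starts.\<close>
  from step_butlast_tm_left[of "str_tape x", OF this] Suc show ?case
    by (simp add: funpow_Suc_right del: funpow.simps)
qed simp

text \<open>State 0 runs to the blank behind the input, state 1 erases the last letter, state 2
  returns to the blank at \<open>- 1\<close>, and state 3 halts on cell 0. For nonempty
  \<open>x\<close> this takes \<open>length x\<close>, 1, 1, \<open>length x - 1\<close> and 1
  steps. On empty input the machine halts in state 1 on a blank, which already reads as the output
  \<open>[]\<close>.\<close>

lemma steps_butlast_tm:
  "(step butlast_tm ^^ (2 * length x + 2)) (initial x) =
    (if x = [] then \<lparr>state = 1, head = - 1, tape = str_tape []\<rparr>
     else \<lparr>state = 3, head = 0, tape = str_tape (butlast x)\<rparr>)"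
proof (cases x rule: rev_exhaust)
  case Nil
  have "str_tape [] i = Blank" for i
    by (simp add: str_tape_def)
  with Nil show ?thesis
    by (simp add: initial_eq numeral_2_eq_2 step_butlast_tm_Blank[simplified])
next
  case (snoc w b)
  have end_blank: "str_tape x (int (length x)) = Blank"
    by (simp add: str_tape_def)
  have last: "str_tape x (int (length w)) = Bit b"
    using snoc by (simp add: str_tape_def)
  have erased: "(str_tape x)(int (length w) := Blank) = str_tape w"
    using snoc by (auto simp: str_tape_def nth_append fun_eq_iff)
  have "2 * length x + 2 = Suc (length w + Suc (Suc (length x)))"
    using snoc by simp
  then have "(step butlast_tm ^^ (2 * length x + 2)) (initial x) =
      step butlast_tm ((step butlast_tm ^^ length w) (step butlast_tm (step butlast_tm
        ((step butlast_tm ^^ length x) (initial x)))))"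
    by (simp only: funpow.simps funpow_add o_apply)
  also have "(step butlast_tm ^^ length x) (initial x) =
      \<lparr>state = 0, head = int (length x), tape = str_tape x\<rparr>"
    by (simp add: initial_eq steps_butlast_tm_right)
  also have "step butlast_tm \<dots> = \<lparr>state = 1, head = int (length w), tape = str_tape x\<rparr>"
    using step_butlast_tm_Blank(1)[of "str_tape x", OF end_blank] snoc by simp
  also have "step butlast_tm \<dots> = \<lparr>state = 2, head = int (length w) - 1, tape = str_tape w\<rparr>"
    by (simp only: step_butlast_tm_erase[of "str_tape x", OF last] erased)
  also have "(step butlast_tm ^^ length w) \<dots> = \<lparr>state = 2, head = - 1, tape = str_tape w\<rparr>"
    by (simp add: steps_butlast_tm_left)
  also have "step butlast_tm \<dots> = \<lparr>state = 3, head = 0, tape = str_tape w\<rparr>"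
    by (simp add: step_butlast_tm_Blank str_tape_def)
  finally show ?thesis
    using snoc by simp
qed

lemma polytime_butlast: "polytime butlast"
  unfolding polytime_def
proof (intro exI allI)
  fix x :: str
  have "computes_within butlast_tm x (2 * length x + 2) (butlast x)"
    unfolding computes_within_def steps_butlast_tm Let_def
    by (auto simp: halted_def transition_def butlast_tm_def has_output_def str_tape_def)
  then show "computes_within butlast_tm x (poly [:2, 2:] (length x)) (butlast x)"
    by (simp add: mult_2 mult_2_right)
qed

section \<open>Ranking sets given by arbitrary choices\<close>

definition choice_set :: "(str \<Rightarrow> bool) \<Rightarrow> str set" where
  "choice_set b = {w @ [b w] | w. w \<noteq> []}"

text \<open>Either \<open>v\<close> is shorter, or the lengths agree and the first difference
  decides; the appended letters change neither.\<close>

lemma str_snoc_less: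
  fixes v w :: str
  assumes "v < w"
  shows "v @ [c] < w @ [d]"
  using assms by (auto simp: list_less_def intro: lenlex_append1)

lemma str_snoc_le_iff: "v @ [b v] \<le> w @ [b w] \<longleftrightarrow> v \<le> w" for v w :: str
  using str_snoc_less[of v w "b v" "b w"] str_snoc_less[of w v "b w" "b v"]
  by (cases v w rule: linorder_cases) auto

lemma rank_choice_set:
  assumes "w \<noteq> []"
  shows "rank (choice_set b) (w @ [b w]) = nat_of_str w"
proof -
  have "{z. z \<le> w @ [b w] \<and> z \<in> choice_set b} = (\<lambda>v. v @ [b v]) ` ({v. v \<le> w} - {[]})"
    by (auto simp: choice_set_def str_snoc_le_iff)
  moreover have "inj_on (\<lambda>v. v @ [b v]) ({v. v \<le> w} - {[]})"
    by (rule inj_onI) simp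
  ultimately have "rank (choice_set b) (w @ [b w]) = card ({v. v \<le> w} - {[]})"
    unfolding rank_def by (simp only: card_image)
  \<comment> \<open>Leaving out \<open>[]\<close> makes up for counting \<open>w\<close> itself, so
    what remains is the number of \<open>v < w\<close>.\<close>
  also have "\<dots> = card {v. v \<le> w} - 1"
    by (rule card_Diff_singleton) simp
  also have "{v. v \<le> w} = insert w {v. v < w}"
    by auto
  also have "card \<dots> - 1 = nat_of_str w"
    by (simp add: nat_of_str_def finite_lessThan_str)
  finally show ?thesis .
qed

lemma P_rankable_choice_set: "P_rankable (choice_set b)"
  unfolding P_rankable_def
proof (intro exI conjI)
  show "polytime butlast"
    by (rule polytime_butlast)
  have "nat_of_str (butlast x) = rank (choice_set b) x" if x: "x \<in> choice_set b" for x
  proof -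
    obtain w where "w \<noteq> []" "x = w @ [b w]"
      using x by (auto simp: choice_set_def)
    then show ?thesis
      by (simp add: rank_choice_set)
  qed
  then show "ranking_function (\<lambda>x. Some (butlast x)) (choice_set b)"
    by (auto simp: ranking_function_def)
qed

section \<open>Countably many functions against an uncountable chain of sets\<close>

instance symbol :: countable by countable_datatype

instance move :: countable by countable_datatype

lemma countable_partial_recursive: "countable (Collect partial_recursive)"
proof -
  \<comment> \<open>If \<open>M\<close> computes \<open>f\<close>, the only candidate for
    \<open>w\<close> is the value of \<open>f\<close> at \<open>x\<close>, so the choice recovers
    \<open>f\<close> from \<open>M\<close>. Machines are lists over countable types, hence countable
    in number.\<close>
  define computed where
    "computed M = (\<lambda>x. if \<exists>w t. computes_within M x t w
       then Some (SOME w. \<exists>t. computes_within M x t w) else None)" for M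
  have "f = computed M" if M: "\<And>x w. f x = Some w \<longleftrightarrow> (\<exists>t. computes_within M x t w)" for f M
  proof
    fix x
    show "f x = computed M x"
      unfolding computed_def by (cases "f x") (auto simp flip: M)
  qed
  then have "Collect partial_recursive \<subseteq> range computed"
    unfolding partial_recursive_def by blast
  then show ?thesis
    by (rule countable_subset) simp
qed

text \<open>Both images are \<open>UNIV\<close>, so a point of \<open>E\<close> outside
  \<open>D\<close> would share its value with a point of \<open>D\<close>, against injectivity on
  \<open>E\<close>.\<close>

lemma compression_function_subset_eq:
  assumes "compression_function f D" "compression_function f E" "D \<subseteq> E"
  shows "D = E"
  using assms unfolding compression_function_def by (metis inj_on_image_eq_iff subset_refl)

lemma exists_incompressible_in_chain:
  fixes D :: "real \<Rightarrow> str set"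
  assumes "strict_mono D"
  obtains r where "\<not> F_PR_compressible (D r)"
proof (rule ccontr)
  assume "\<not> thesis"
  with that have "\<forall>r. \<exists>f. partial_recursive f \<and> compression_function f (D r)"
    unfolding F_PR_compressible_def by blast
  then obtain F where F: "\<And>r. partial_recursive (F r)" "\<And>r. compression_function (F r) (D r)"
    by metis
  have "inj F"
  proof (rule linorder_injI)
    fix r s :: real
    assume "r < s"
    then have "D r \<subset> D s"
      using assms by (simp add: strict_monoD)
    then show "F r \<noteq> F s"
      using compression_function_subset_eq[of "F s" "D r" "D s"] F(2)[of r] F(2)[of s] by auto
  qed
  moreover have "countable (range F)"
    using countable_partial_recursive by (rule countable_subset[rotated]) (use F in auto)
  ultimately show False
    using countable_image_inj_on uncountable_UNIV_real by blast
qed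

text \<open>The lower Dedekind cut of \<open>r\<close>, with rationals coded in unary. The
  \<open>Suc\<close> keeps the codes nonempty, as members of a \<open>choice_set\<close> extend
  nonempty strings only.\<close>

definition cut_set :: "real \<Rightarrow> str set" where
  "cut_set r = {replicate (Suc (to_nat q)) False | q. of_rat q < r}"

lemma replicate_mem_cut_set_iff: "replicate (Suc (to_nat q)) False \<in> cut_set r \<longleftrightarrow> of_rat q < r"
  by (auto simp: cut_set_def simp del: replicate_Suc)

lemma infinite_cut_set: "infinite (cut_set r)"
proof -
  have "infinite {q. of_rat q < r}"
  \<comment> \<open>If finite, the cut would have a least element, since it is nonempty; but it is
    closed under subtracting 1.\<close>
  proof
    assume "finite {q. of_rat q < r}"
    moreover obtain q0 where "of_rat q0 < r"
      using of_rat_dense[of "r - 1" r] by auto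
    ultimately have m: "Min {q. of_rat q < r} \<in> {q. of_rat q < r}"
      by (intro Min_in) auto
    then have "Min {q. of_rat q < r} - 1 \<in> {q. of_rat q < r}"
      by (simp add: of_rat_diff)
    with \<open>finite _\<close> have "Min {q. of_rat q < r} \<le> Min {q. of_rat q < r} - 1"
      by (rule Min_le)
    then show False by simp
  qed
  moreover have "inj (\<lambda>q :: rat. replicate (Suc (to_nat q)) False)"
    by (rule injI) (metis inj_to_nat injD length_replicate nat.inject)
  ultimately show ?thesis
    unfolding cut_set_def by (simp add: finite_image_iff inj_on_subset setcompr_eq_image
        del: replicate_Suc)
qed

text \<open>The code of a rational strictly between \<open>r\<close> and \<open>s\<close> lies in
  the second cut but not in the first.\<close>

lemma strict_mono_snoc_cut_set: "strict_mono (\<lambda>r. (\<lambda>w. w @ [False]) ` cut_set r)"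
proof (rule strict_monoI)
  fix r s :: real
  assume "r < s"
  then obtain q where q: "r < of_rat q" "of_rat q < s"
    using of_rat_dense by blast
  then have "cut_set r \<noteq> cut_set s"
    using replicate_mem_cut_set_iff[of q r] replicate_mem_cut_set_iff[of q s] by auto
  moreover have "cut_set r \<subseteq> cut_set s"
    using \<open>r < s\<close> by (fastforce simp: cut_set_def)
  moreover have "inj (\<lambda>w :: str. w @ [False])"
    by (rule injI) simp
  ultimately show "(\<lambda>w. w @ [False]) ` cut_set r \<subset> (\<lambda>w. w @ [False]) ` cut_set s"
    by (metis image_mono inj_image_eq_iff psubsetI)
qed

theorem theorem20:
  shows "\<exists>A B :: str set.
    P_rankable A \<and> P_rankable B \<and> infinite (A \<inter> B) \<and> \<not> F_PR_compressible (A \<inter> B)"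
proof -
  obtain r where r: "\<not> F_PR_compressible ((\<lambda>w. w @ [False]) ` cut_set r)"
    using exists_incompressible_in_chain[OF strict_mono_snoc_cut_set] .
  define A where "A = choice_set (\<lambda>_. False)"
  \<comment> \<open>\<open>B\<close> appends \<open>False\<close> exactly to the nonempty strings in
    \<open>cut_set r\<close>, so it agrees with \<open>A\<close> there and nowhere else.\<close>
  define B where "B = choice_set (\<lambda>w. w \<notin> cut_set r)"
  have "[] \<notin> cut_set r"
    by (auto simp: cut_set_def)
  then have eq: "A \<inter> B = (\<lambda>w. w @ [False]) ` cut_set r"
    by (auto simp: A_def B_def choice_set_def)
  moreover have "infinite ((\<lambda>w. w @ [False]) ` cut_set r)"
    using infinite_cut_set[of r] by (subst finite_image_iff) (auto intro: inj_onI)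
  ultimately show ?thesis
    using r P_rankable_choice_set unfolding A_def B_def by metis
qed

end
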